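(* Let $(\mathcal{X},\mathcal{F})$ be a measurable space with $\mathcal{X}$ nonempty. (i) Every Renyi space $(\mathcal{X},\mathcal{F},\nu)$ has a unique extension to a maximal Renyi space on $(\mathcal{X},\mathcal{F})$. (ii) The set of maximal Renyi spaces on $(\mathcal{X},\mathcal{F})$ is in one-one correspondence with the set of C-measure spaces on $(\mathcal{X},\mathcal{F})$, the correspondence being the map that sends a C-measure space $(\mathcal{X},\mathcal{F},[\mu])$ to the Renyi space it generates, i.e. $(\mathcal{X},\mathcal{F})$ equipped with the family $\{\mu(\cdot\mid A)\mid A\in\mathcal{F},\ 0<\mu(A)<\infty\}$.
   Context: Let $\mathcal{X}$ be a nonempty set equipped with a $\sigma$-field $\mathcal{F}$. **C-measures.** For a measure $\mu:\mathcal{F}\to[0,\infty]$, a set $A\in\mathcal{F}$ is admissible if $0<\mu(A)<\infty$. The measure $\mu$ is $\sigma$-finite if there is a sequence $A_1,A_2,\ldots$ of admissible sets with $\mathcal{X}=\bigcup_i A_i$. Two $\sigma$-finite measures $\mu,\nu$ on $(\mathcal{X},\mathcal{F})$ are equivalent if $\mu=\alpha\nu$ for some real $\alpha>0$; an equivalence class $\gamma=[\mu]$ is called a C-measure (or conditional measure), and $(\mathcal{X},\mathcal{F},\gamma)$ is a C-measure space. For $\gamma=[\mu]$ and $A$ admissible, $\gamma(B\mid A)=\mu(B\mid A)=\mu(B\cap A)/\mu(A)$ for $B\in\mathcal{F}$; admissibility and this value do not depend on the representative $\mu$. **Bunch.** A family $\mathcal{B}\subset\mathcal{F}$ is a bunch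 in $\mathcal{X}$ if (1) $B_1,B_2\in\mathcal{B}$ implies $B_1\cup B_2\in\mathcal{B}$; (2) there exist $B_1,B_2,\ldots\in\mathcal{B}$ with $\bigcup_i B_i=\mathcal{X}$; (3) $\emptyset\notin\mathcal{B}$. **Renyi space.** A Renyi space $(\mathcal{X},\mathcal{F},\nu)$ is a measurable space $(\mathcal{X},\mathcal{F})$ equipped with a family $\{\nu(\cdot\mid B)\mid B\in\mathcal{B}\}$ of probability measures on $(\mathcal{X},\mathcal{F})$ indexed by a bunch $\mathcal{B}$ such that whenever $B_1,B_2\in\mathcal{B}$ and $B_1\subset B_2$, one has $\nu(B_1\mid B_2)>0$ and $$\nu(A\mid B_1)=\frac{\nu(A\cap B_1\mid B_2)}{\nu(B_1\mid B_2)}\quad\text{for all }A\in\mathcal{F}.$$ **Extensions.** A Renyi space $(\mathcal{X},\mathcal{F},\nu_2)$ with bunch $\mathcal{B}_2$ extends a Renyi space $(\mathcal{X},\mathcal{F},\nu_1)$ with bunch $\mathcal{B}_1$ if $\mathcal{B}_1\subset\mathcal{B}_2$ and $\nu_1(\cdot\mid B)=\nu_2(\cdot\mid B)$ for all $B\in\mathcal{B}_1$. The extension is strict if $\mathcal{B}_1\neq\mathcal{B}_2$. A Renyi space is maximal if it has no strict extension. **Renyi space generated by a C-measure.** A C-measure space $(\mathcal{X},\mathcal{F},[\mu])$ generates the Renyi space whose bunch is the family of all admissible sets $A$ and whose probability measures are $\mu(\cdot\mid A)$. *)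

theory Defs
  imports "HOL-Probability.Probability"
begin

text \<open>
  A measurable space is given by a value M of type \<open>'a measure\<close>, of which only \<open>space M\<close> and
  \<open>sets M\<close> are used; the measure carried by M plays no role.
\<close>

subsection \<open>C-measures\<close>

definition admissible :: "'a measure \<Rightarrow> 'a set \<Rightarrow> bool" where
  "admissible \<mu> A \<longleftrightarrow> A \<in> sets \<mu> \<and> 0 < emeasure \<mu> A \<and> emeasure \<mu> A < \<infinity>"

text \<open>
  The covering sets must have positive measure. So, unlike for the locale
  \<open>sigma_finite_measure\<close>, the zero measure does not qualify on a nonempty space.
\<close>

definition sigma_finite_measures_on :: "'a measure \<Rightarrow> 'a measure set" where
  "sigma_finite_measures_on M =
     {\<mu>. space \<mu> = space M \<and> sets \<mu> = sets M \<and>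
         (\<exists>A :: nat \<Rightarrow> 'a set. (\<forall>i. admissible \<mu> (A i)) \<and> (\<Union>i. A i) = space M)}"

definition c_equiv :: "'a measure \<Rightarrow> ('a measure \<times> 'a measure) set" where
  "c_equiv M =
     {(\<mu>, \<nu>). \<mu> \<in> sigma_finite_measures_on M \<and> \<nu> \<in> sigma_finite_measures_on M \<and>
              (\<exists>\<alpha>::real. \<alpha> > 0 \<and> \<mu> = scale_measure (ennreal \<alpha>) \<nu>)}"

definition c_measures :: "'a measure \<Rightarrow> 'a measure set set" where
  "c_measures M = sigma_finite_measures_on M // c_equiv M"

subsection \<open>Renyi spaces\<close>

definition bunch :: "'a measure \<Rightarrow> 'a set set \<Rightarrow> bool" where
  "bunch M \<B> \<longleftrightarrow>
     \<B> \<subseteq> sets M \<and>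
     (\<forall>B1\<in>\<B>. \<forall>B2\<in>\<B>. B1 \<union> B2 \<in> \<B>) \<and>
     (\<exists>B :: nat \<Rightarrow> 'a set. (\<forall>i. B i \<in> \<B>) \<and> (\<Union>i. B i) = space M) \<and>
     {} \<notin> \<B>"

text \<open>
  A family of measures indexed by a bunch is a partial map whose domain is the bunch.
  Two families are then equal as maps iff they have the same bunch and the same measures.
\<close>

type_synonym 'a cond_family = "'a set \<rightharpoonup> 'a measure"

definition renyi_space :: "'a measure \<Rightarrow> 'a cond_family \<Rightarrow> bool" where
  "renyi_space M \<nu> \<longleftrightarrow>
     bunch M (dom \<nu>) \<and>
     (\<forall>B\<in>dom \<nu>. space (the (\<nu> B)) = space M \<and> sets (the (\<nu> B)) = sets M \<and>
                 prob_space (the (\<nu> B))) \<and>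
     (\<forall>B1\<in>dom \<nu>. \<forall>B2\<in>dom \<nu>. B1 \<subseteq> B2 \<longrightarrow>
        measure (the (\<nu> B2)) B1 > 0 \<and>
        (\<forall>A\<in>sets M. measure (the (\<nu> B1)) A =
                     measure (the (\<nu> B2)) (A \<inter> B1) / measure (the (\<nu> B2)) B1))"

definition renyi_extends :: "'a measure \<Rightarrow> 'a cond_family \<Rightarrow> 'a cond_family \<Rightarrow> bool" where
  "renyi_extends M \<nu>2 \<nu>1 \<longleftrightarrow>
     renyi_space M \<nu>2 \<and> renyi_space M \<nu>1 \<and>
     dom \<nu>1 \<subseteq> dom \<nu>2 \<and> (\<forall>B\<in>dom \<nu>1. \<nu>1 B = \<nu>2 B)"

definition maximal_renyi_space :: "'a measure \<Rightarrow> 'a cond_family \<Rightarrow> bool" where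
  "maximal_renyi_space M \<nu> \<longleftrightarrow>
     renyi_space M \<nu> \<and> \<not> (\<exists>\<nu>'. renyi_extends M \<nu>' \<nu> \<and> dom \<nu> \<noteq> dom \<nu>')"

subsection \<open>The Renyi space generated by a C-measure\<close>

text \<open>
  \<open>uniform_measure \<mu> A\<close> is the conditional measure, with values
  \<open>emeasure \<mu> (A \<inter> B) / emeasure \<mu> A\<close>.
\<close>

definition conditionals :: "'a measure \<Rightarrow> 'a cond_family" where
  "conditionals \<mu> = (\<lambda>A. if admissible \<mu> A then Some (uniform_measure \<mu> A) else None)"

text \<open>
  All representatives of a C-measure have the same conditionals, so the image below is a
  singleton; see \<open>generated_renyi_class\<close>.
\<close>

definition generated_renyi :: "'a measure set \<Rightarrow> 'a cond_family" where
  "generated_renyi \<gamma> = the_elem (conditionals ` \<gamma>)"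

lemma equiv_c_equiv: "equiv (sigma_finite_measures_on M) (c_equiv M)"
proof (rule equivI)
  show "c_equiv M \<subseteq> sigma_finite_measures_on M \<times> sigma_finite_measures_on M"
    by (auto simp: c_equiv_def)
  show "refl_on (sigma_finite_measures_on M) (c_equiv M)"
    by (auto simp: refl_on_def c_equiv_def intro!: exI[of _ 1])
  show "sym (c_equiv M)"
  proof (rule symI)
    fix \<mu> \<nu> assume "(\<mu>, \<nu>) \<in> c_equiv M"
    then obtain \<alpha> :: real where *: "\<alpha> > 0" "\<mu> = scale_measure (ennreal \<alpha>) \<nu>"
      "\<mu> \<in> sigma_finite_measures_on M" "\<nu> \<in> sigma_finite_measures_on M"
      by (auto simp: c_equiv_def)
    then have "\<nu> = scale_measure (ennreal (1 / \<alpha>)) \<mu>"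
      by (simp flip: ennreal_mult)
    with * show "(\<nu>, \<mu>) \<in> c_equiv M"
      unfolding c_equiv_def by (auto intro!: exI[of _ "1 / \<alpha>"] simp flip: ennreal_mult)
  qed
  show "trans (c_equiv M)"
  proof (rule transI)
    fix \<mu> \<nu> \<rho> assume "(\<mu>, \<nu>) \<in> c_equiv M" "(\<nu>, \<rho>) \<in> c_equiv M"
    then obtain \<alpha> \<beta> :: real where "\<alpha> > 0" "\<beta> > 0" "\<mu> = scale_measure (ennreal \<alpha>) \<nu>"
      "\<nu> = scale_measure (ennreal \<beta>) \<rho>"
      "\<mu> \<in> sigma_finite_measures_on M" "\<rho> \<in> sigma_finite_measures_on M"
      by (auto simp: c_equiv_def)
    then show "(\<mu>, \<rho>) \<in> c_equiv M"
      unfolding c_equiv_def by (auto intro!: exI[of _ "\<alpha> * \<beta>"] simp: ennreal_mult)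
  qed
qed

lemma conditionals_scale_measure:
  fixes \<alpha> :: real
  assumes "\<alpha> > 0"
  shows "conditionals (scale_measure (ennreal \<alpha>) \<mu>) = conditionals \<mu>"
proof
  fix A
  have adm: "admissible (scale_measure (ennreal \<alpha>) \<mu>) A \<longleftrightarrow> admissible \<mu> A"
    using assms by (auto simp: admissible_def ennreal_zero_less_mult_iff ennreal_mult_less_top)
  have "uniform_measure (scale_measure (ennreal \<alpha>) \<mu>) A = uniform_measure \<mu> A"
    if "admissible \<mu> A"
  proof (rule measure_eqI)
    fix B assume "B \<in> sets (uniform_measure (scale_measure (ennreal \<alpha>) \<mu>) A)"
    with that assms show "emeasure (uniform_measure (scale_measure (ennreal \<alpha>) \<mu>) A) B
        = emeasure (uniform_measure \<mu> A) B"
      by (simp add: admissible_def ennreal_mult_divide_eq divide_ennreal_def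
          ennreal_inverse_mult ac_simps)
         (simp add: ennreal_inverse_mult inverse_ennreal mult.assoc[symmetric]
          flip: ennreal_mult)
  qed simp
  with adm show "conditionals (scale_measure (ennreal \<alpha>) \<mu>) A = conditionals \<mu> A"
    by (simp add: conditionals_def)
qed

lemma generated_renyi_class:
  assumes "\<mu> \<in> sigma_finite_measures_on M"
  shows "generated_renyi (c_equiv M `` {\<mu>}) = conditionals \<mu>"
proof -
  have "conditionals \<nu> = conditionals \<mu>" if "\<nu> \<in> c_equiv M `` {\<mu>}" for \<nu>
    using that by (auto simp: c_equiv_def conditionals_scale_measure)
  moreover have "\<mu> \<in> c_equiv M `` {\<mu>}"
    using assms by (rule equiv_class_self[OF equiv_c_equiv])
  ultimately have "conditionals ` (c_equiv M `` {\<mu>}) = {conditionals \<mu>}"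
    by blast
  then show ?thesis
    by (simp add: generated_renyi_def)
qed

end

theory Submission
  imports Defs
begin

text \<open>
  Fix a set \<open>C\<close> of the bunch and give each \<open>B\<close> of the bunch the weight
  \<open>w B = \<nu>(B | B \<union> C) / \<nu>(C | B \<union> C)\<close>. For \<open>A \<subseteq> B \<inter> B'\<close> both \<open>w B \<nu>(A | B)\<close> and \<open>w B' \<nu>(A | B')\<close>
  equal \<open>\<nu>(A | D) / \<nu>(C | D)\<close> with \<open>D = B \<union> B' \<union> C\<close>, so the finite measures \<open>w B \<nu>(\<cdot> | B)\<close>
  glue to a \<open>\<sigma>\<close>-finite measure whose conditionals extend \<open>\<nu>\<close>. The same ratios show that this
  measure is determined by \<open>\<nu>\<close> up to a factor. Hence the conditionals of a \<open>\<sigma>\<close>-finite measure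
  have no strict extension, and they are the only maximal Renyi spaces.
\<close>

subsection \<open>Sigma-finite measures and their conditionals\<close>

lemma dom_conditionals: "dom (conditionals \<mu>) = Collect (admissible \<mu>)"
  by (auto simp: conditionals_def split: if_splits)

lemma map_le_conditionalsD:
  assumes "\<nu> \<subseteq>\<^sub>m conditionals \<mu>" "B \<in> dom \<nu>"
  shows "admissible \<mu> B" "\<nu> B = Some (uniform_measure \<mu> B)"
proof -
  have "\<nu> B = conditionals \<mu> B" "\<nu> B \<noteq> None"
    using assms unfolding map_le_def domIff by blast+
  then show "admissible \<mu> B" "\<nu> B = Some (uniform_measure \<mu> B)"
    by (auto simp: conditionals_def split: if_splits)
qed

lemma admissible_sets: "admissible \<mu> B \<Longrightarrow> B \<in> sets \<mu>"
  by (simp add: admissible_def)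

lemma measure_pos_if_admissible: "admissible \<mu> B \<Longrightarrow> 0 < measure \<mu> B"
  by (auto simp: admissible_def measure_def enn2real_positive_iff)

lemma emeasure_less_top_if_subset_admissible:
  assumes "admissible \<mu> B" "A \<subseteq> B"
  shows "emeasure \<mu> A < \<infinity>"
  using emeasure_mono[of A B \<mu>] assms by (auto simp: admissible_def dest: le_less_trans)

lemma measure_uniform_measure_admissible:
  "admissible \<mu> B \<Longrightarrow> A \<in> sets \<mu> \<Longrightarrow>
    measure (uniform_measure \<mu> B) A = measure \<mu> (B \<inter> A) / measure \<mu> B"
  by (rule measure_uniform_measure) (auto simp: admissible_def)

lemma admissible_Un:
  assumes "admissible \<mu> A" "admissible \<mu> B"
  shows "admissible \<mu> (A \<union> B)"
proof -
  have "emeasure \<mu> A \<le> emeasure \<mu> (A \<union> B)"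
    using assms by (intro emeasure_mono) (auto simp: admissible_def)
  moreover have "emeasure \<mu> (A \<union> B) \<le> emeasure \<mu> A + emeasure \<mu> B"
    using assms by (intro emeasure_subadditive) (auto simp: admissible_def)
  moreover have "emeasure \<mu> A + emeasure \<mu> B < \<infinity>"
    using assms by (auto simp: admissible_def ennreal_add_less_top)
  ultimately show ?thesis
    using assms by (auto simp: admissible_def intro: less_le_trans le_less_trans)
qed

text \<open>The cover by admissible sets supplies the covering clause of a bunch, and subadditivity
  keeps unions of two admissible sets finite. In the conditioning identity the factor
  \<open>measure \<mu> B2\<close> cancels.\<close>

lemma renyi_space_conditionals:
  assumes "\<mu> \<in> sigma_finite_measures_on M"
  shows "renyi_space M (conditionals \<mu>)"
proof -
  have sp: "space \<mu> = space M" and se: "sets \<mu> = sets M"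
    using assms by (auto simp: sigma_finite_measures_on_def)
  have "bunch M (dom (conditionals \<mu>))"
    unfolding bunch_def dom_conditionals
  proof (intro conjI)
    show "\<exists>B :: nat \<Rightarrow> 'a set. (\<forall>i. B i \<in> Collect (admissible \<mu>)) \<and> (\<Union>i. B i) = space M"
      using assms by (simp add: sigma_finite_measures_on_def)
  qed (use se in \<open>auto intro: admissible_Un simp: admissible_def[of _ "{}"] dest: admissible_sets\<close>)
  moreover have "prob_space (uniform_measure \<mu> B)" if "admissible \<mu> B" for B
    using that by (intro prob_space_uniform_measure) (auto simp: admissible_def)
  moreover have "measure (uniform_measure \<mu> B2) B1 > 0 \<and>
        (\<forall>A\<in>sets M. measure (uniform_measure \<mu> B1) A =
            measure (uniform_measure \<mu> B2) (A \<inter> B1) / measure (uniform_measure \<mu> B2) B1)"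
    if "admissible \<mu> B1" "admissible \<mu> B2" "B1 \<subseteq> B2" for B1 B2
  proof -
    have "B1 \<in> sets \<mu>" "B2 \<inter> B1 = B1"
      using that by (auto simp: admissible_def)
    moreover have "B2 \<inter> (A \<inter> B1) = B1 \<inter> A" for A
      using that by auto
    ultimately show ?thesis
      using that measure_pos_if_admissible[of \<mu> B1] measure_pos_if_admissible[of \<mu> B2]
      by (simp add: measure_uniform_measure_admissible flip: se)
  qed
  ultimately show ?thesis
    unfolding renyi_space_def dom_conditionals Ball_def mem_Collect_eq
    using sp se by (simp add: conditionals_def)
qed

text \<open>Each piece \<open>A \<inter> disjointed B n\<close> lies inside \<open>B n\<close>. With
  a cover from the bunch, a measure is therefore known everywhere once it is known on subsets of
  members of the bunch.\<close>

lemma emeasure_eq_suminf_disjointed: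
  assumes "range B \<subseteq> sets \<mu>" "(\<Union>i. B i) = space \<mu>" "A \<in> sets \<mu>"
  shows "emeasure \<mu> A = (\<Sum>n. emeasure \<mu> (A \<inter> disjointed B n))"
proof -
  have "(\<Sum>n. emeasure \<mu> (A \<inter> disjointed B n)) = emeasure \<mu> (\<Union>n. A \<inter> disjointed B n)"
    using sets.range_disjointed_sets[OF assms(1)] assms(3) disjoint_family_disjointed[of B]
    by (intro suminf_emeasure) (auto simp: disjoint_family_on_def)
  also have "(\<Union>n. A \<inter> disjointed B n) = A"
    using assms sets.sets_into_space[OF assms(3)] by (simp add: UN_disjointed_eq flip: Int_UN_distrib)
  finally show ?thesis ..
qed

text \<open>Uniqueness up to a factor: agreement on the conditionals of one bunch fixes all ratios
  of measures inside its members. Maximality, uniqueness of the maximal extension and injectivity of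
  the correspondence all rest on this.\<close>

lemma c_equiv_if_map_le_conditionals:
  assumes \<mu>: "\<mu> \<in> sigma_finite_measures_on M" "\<nu> \<subseteq>\<^sub>m conditionals \<mu>"
    and \<mu>': "\<mu>' \<in> sigma_finite_measures_on M" "\<nu> \<subseteq>\<^sub>m conditionals \<mu>'"
    and bunch: "bunch M (dom \<nu>)"
  shows "(\<mu>', \<mu>) \<in> c_equiv M"
proof -
  have se: "sets \<mu> = sets M" "sets \<mu>' = sets M" "space \<mu> = space M"
    using \<mu> \<mu>' by (auto simp: sigma_finite_measures_on_def)
  note adm = map_le_conditionalsD(1)[OF \<mu>(2)] map_le_conditionalsD(1)[OF \<mu>'(2)]
  have ratio: "measure \<mu>' A / measure \<mu>' D = measure \<mu> A / measure \<mu> D"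
    if "D \<in> dom \<nu>" "A \<in> sets M" "A \<subseteq> D" for A D
  proof -
    have "uniform_measure \<mu>' D = uniform_measure \<mu> D"
      using map_le_conditionalsD(2)[OF \<mu>(2) that(1)] map_le_conditionalsD(2)[OF \<mu>'(2) that(1)]
      by simp
    moreover have "D \<inter> A = A"
      using that by blast
    ultimately show ?thesis
      using measure_uniform_measure_admissible[of \<mu> D A] measure_uniform_measure_admissible[of \<mu>' D A]
        adm[OF that(1)] that se by simp
  qed
  obtain B :: "nat \<Rightarrow> 'a set" where B: "\<And>i. B i \<in> dom \<nu>" "(\<Union>i. B i) = space M"
    using bunch unfolding bunch_def by metis
  have Un: "B1 \<union> B2 \<in> dom \<nu>" if "B1 \<in> dom \<nu>" "B2 \<in> dom \<nu>" for B1 B2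
    using bunch that by (auto simp: bunch_def)
  have sub: "dom \<nu> \<subseteq> sets M"
    using bunch by (auto simp: bunch_def)
  \<comment> \<open>The set \<open>B 0\<close> serves as a yardstick: its two measures leave only
    this value for the factor.\<close>
  define \<alpha> where "\<alpha> = measure \<mu>' (B 0) / measure \<mu> (B 0)"
  have pos: "measure \<mu>' D > 0" "measure \<mu> D > 0" if "D \<in> dom \<nu>" for D
    using adm[OF that] by (auto intro: measure_pos_if_admissible)
  have \<alpha>: "\<alpha> > 0"
    using pos[OF B(1)[of 0]] by (simp add: \<alpha>_def)
  have scale: "emeasure \<mu>' A = ennreal \<alpha> * emeasure \<mu> A"
    if A: "A \<in> sets M" "A \<subseteq> D" "D \<in> dom \<nu>" for A D
  proof -
    \<comment> \<open>The sets \<open>A\<close> and \<open>B 0\<close> need not share a member of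
      the cover, but both lie in \<open>D \<union> B 0\<close>, where the ratios for
      \<open>\<mu>\<close> and \<open>\<mu>'\<close> agree.\<close>
    have E: "D \<union> B 0 \<in> dom \<nu>"
      using Un A B by blast
    have "measure \<mu>' A / measure \<mu>' (D \<union> B 0) = measure \<mu> A / measure \<mu> (D \<union> B 0)"
      using A by (intro ratio E) auto
    moreover have "measure \<mu>' (B 0) / measure \<mu>' (D \<union> B 0) = measure \<mu> (B 0) / measure \<mu> (D \<union> B 0)"
      using sub B(1)[of 0] by (intro ratio E) auto
    ultimately have
      "measure \<mu>' A = measure \<mu> A / measure \<mu> (D \<union> B 0) * measure \<mu>' (D \<union> B 0)"
      "measure \<mu>' (B 0) = measure \<mu> (B 0) / measure \<mu> (D \<union> B 0) * measure \<mu>' (D \<union> B 0)"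
      using pos(1)[OF E] by (metis less_irrefl nonzero_divide_eq_eq)+
    then have "measure \<mu>' A = \<alpha> * measure \<mu> A"
      using pos(2)[OF B(1)[of 0]] by (simp add: \<alpha>_def)
    \<comment> \<open>Since \<open>measure\<close> is 0 on sets of infinite measure, the return to
      \<open>emeasure\<close> needs finiteness, which \<open>A\<close> inherits from the admissible
      set \<open>D\<close>.\<close>
    moreover have "emeasure \<mu> A = ennreal (measure \<mu> A)" "emeasure \<mu>' A = ennreal (measure \<mu>' A)"
      using emeasure_less_top_if_subset_admissible[OF _ A(2)] adm[OF A(3)]
      by (auto intro!: emeasure_eq_ennreal_measure dest: less_imp_neq)
    ultimately show ?thesis
      using \<alpha> by (simp add: ennreal_mult)
  qed
  have ran: "range B \<subseteq> sets M"
    using sub B by blast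
  have "emeasure \<mu>' A = ennreal \<alpha> * emeasure \<mu> A" if A: "A \<in> sets M" for A
  proof -
    have sp: "space \<mu>' = space M"
      using \<mu>' by (auto simp: sigma_finite_measures_on_def)
    have "emeasure \<mu>' A = (\<Sum>n. emeasure \<mu>' (A \<inter> disjointed B n))"
      using ran B A se sp by (intro emeasure_eq_suminf_disjointed) auto
    also have "\<dots> = (\<Sum>n. ennreal \<alpha> * emeasure \<mu> (A \<inter> disjointed B n))"
    proof (rule suminf_cong)
      fix n
      show "emeasure \<mu>' (A \<inter> disjointed B n) = ennreal \<alpha> * emeasure \<mu> (A \<inter> disjointed B n)"
        using sets.range_disjointed_sets[OF ran] disjointed_subset[of B n] A B
        by (intro scale[of _ "B n"]) auto
    qed
    also have "\<dots> = ennreal \<alpha> * (\<Sum>n. emeasure \<mu> (A \<inter> disjointed B n))"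
      by (rule ennreal_suminf_cmult)
    also have "(\<Sum>n. emeasure \<mu> (A \<inter> disjointed B n)) = emeasure \<mu> A"
      using ran B A se by (intro emeasure_eq_suminf_disjointed[symmetric]) auto
    finally show ?thesis .
  qed
  then have "\<mu>' = scale_measure (ennreal \<alpha>) \<mu>"
    using se by (intro measure_eqI) auto
  with \<mu> \<mu>' \<alpha> show ?thesis
    by (auto simp: c_equiv_def)
qed

lemma conditionals_eq_if_c_equiv: "(\<mu>', \<mu>) \<in> c_equiv M \<Longrightarrow> conditionals \<mu>' = conditionals \<mu>"
  by (auto simp: c_equiv_def conditionals_scale_measure)

subsection \<open>The measure behind a Renyi space\<close>

text \<open>One sum is read as an integral against the counting measure on the naturals, so that
  termwise integration of a nonnegative series applies.\<close>

lemma ennreal_suminf_swap: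
  fixes f :: "nat \<Rightarrow> nat \<Rightarrow> ennreal"
  shows "(\<Sum>i. \<Sum>j. f i j) = (\<Sum>j. \<Sum>i. f i j)"
  using nn_integral_suminf[of "\<lambda>i j. f i j" "count_space UNIV"]
  by (simp add: nn_integral_count_space_nat)

text \<open>This provides the gluing of countably many measures. Countable additivity amounts to
  exchanging two sums of nonnegative terms.\<close>

lemma emeasure_measure_of_suminf:
  fixes N :: "nat \<Rightarrow> 'a measure"
  assumes "\<And>n. sets (N n) = sets M" "A \<in> sets M"
  shows "emeasure (measure_of (space M) (sets M) (\<lambda>A. \<Sum>n. emeasure (N n) A)) A =
    (\<Sum>n. emeasure (N n) A)"
proof (rule emeasure_measure_of_sigma)
  show "sigma_algebra (space M) (sets M)" ..
  show "positive (sets M) (\<lambda>A. \<Sum>n. emeasure (N n) A)"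
    by (simp add: positive_def)
  show "countably_additive (sets M) (\<lambda>A. \<Sum>n. emeasure (N n) A)"
  proof (rule countably_additiveI)
    fix F :: "nat \<Rightarrow> 'a set" assume F: "range F \<subseteq> sets M" "disjoint_family F"
    have "(\<Sum>i. \<Sum>n. emeasure (N n) (F i)) = (\<Sum>n. \<Sum>i. emeasure (N n) (F i))"
      by (rule ennreal_suminf_swap)
    also have "\<dots> = (\<Sum>n. emeasure (N n) (\<Union>i. F i))"
      using F assms by (intro suminf_cong suminf_emeasure) auto
    finally show "(\<Sum>i. \<Sum>n. emeasure (N n) (F i)) = (\<Sum>n. emeasure (N n) (\<Union>i. F i))" .
  qed
qed (rule assms)

locale renyi =
  fixes M :: "'a measure" and \<nu> :: "'a cond_family"
  assumes renyi: "renyi_space M \<nu>"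
begin

abbreviation P :: "'a set \<Rightarrow> 'a set \<Rightarrow> real" where
  "P B A \<equiv> measure (the (\<nu> B)) A"

text \<open>This is the ratio of the measures of \<open>B\<close> and \<open>C\<close> under the
  measure still to be built, which is thereby normalised to give \<open>C\<close> measure 1.\<close>

definition weight :: "'a set \<Rightarrow> 'a set \<Rightarrow> real" where
  "weight C B = P (B \<union> C) B / P (B \<union> C) C"

lemma bunch: "bunch M (dom \<nu>)"
  using renyi unfolding renyi_space_def by (rule conjunct1)

lemma sets_if_dom: "B \<in> dom \<nu> \<Longrightarrow> B \<in> sets M"
  using bunch unfolding bunch_def by (elim conjE subsetD)

lemma dom_Un: "B \<in> dom \<nu> \<Longrightarrow> B' \<in> dom \<nu> \<Longrightarrow> B \<union> B' \<in> dom \<nu>"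
  using bunch unfolding bunch_def by (elim conjE) (drule (1) bspec, drule (1) bspec)

lemma
  assumes "B \<in> dom \<nu>"
  shows space_cond: "space (the (\<nu> B)) = space M"
    and sets_cond: "sets (the (\<nu> B)) = sets M"
    and prob_space_cond: "prob_space (the (\<nu> B))"
  using renyi[unfolded renyi_space_def, THEN conjunct2, THEN conjunct1, rule_format, OF assms]
  by simp_all

lemma
  assumes "B \<in> dom \<nu>" "D \<in> dom \<nu>" "B \<subseteq> D"
  shows P_pos: "P D B > 0"
    and P_conditional: "A \<in> sets M \<Longrightarrow> P B A = P D (A \<inter> B) / P D B"
  using renyi[unfolded renyi_space_def, THEN conjunct2, THEN conjunct2, rule_format, OF assms]
  by blast+

text \<open>Concentration of each conditional measure on its own index is not an axiom. It follows
  from the conditioning identity with all three sets equal to \<open>B\<close>, whose right side is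
  a positive number divided by itself.\<close>

lemma P_self: "B \<in> dom \<nu> \<Longrightarrow> P B B = 1"
  by (metis P_conditional P_pos Int_absorb divide_self less_irrefl order_refl sets_if_dom)

lemma P_restrict:
  assumes "B \<in> dom \<nu>" "A \<in> sets M"
  shows "P B (A \<inter> B) = P B A"
  using P_conditional[OF assms(1) assms(1) order_refl assms(2)] by (simp add: P_self assms(1))

lemma weight_pos: "B \<in> dom \<nu> \<Longrightarrow> C \<in> dom \<nu> \<Longrightarrow> weight C B > 0"
  by (simp add: weight_def P_pos dom_Un)

text \<open>Conditioning on \<open>B\<close> and on \<open>B \<union> C\<close> is carried out
  inside \<open>D\<close>, and the factors \<open>P D B\<close> and
  \<open>P D (B \<union> C)\<close> cancel. What matters is that \<open>B\<close> has disappeared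
  from the right side.\<close>

lemma weight_mult_P:
  assumes "B \<in> dom \<nu>" "C \<in> dom \<nu>" "D \<in> dom \<nu>" "B \<union> C \<subseteq> D" "A \<in> sets M" "A \<subseteq> B"
  shows "weight C B * P B A = P D A / P D C"
proof -
  have E: "B \<union> C \<in> dom \<nu>"
    using assms dom_Un by blast
  have "A \<inter> B = A" "B \<inter> (B \<union> C) = B" "C \<inter> (B \<union> C) = C"
    using assms by auto
  then have "P B A = P D A / P D B" "P (B \<union> C) B = P D B / P D (B \<union> C)"
    "P (B \<union> C) C = P D C / P D (B \<union> C)"
    using P_conditional[of B D A] P_conditional[OF E, of D B] P_conditional[OF E, of D C]
      assms sets_if_dom by auto
  moreover have "P D B > 0" "P D (B \<union> C) > 0"
    using assms E by (auto intro!: P_pos)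
  ultimately show ?thesis
    by (simp add: weight_def)
qed

lemma weight_mult_P_eq:
  assumes "B \<in> dom \<nu>" "B' \<in> dom \<nu>" "C \<in> dom \<nu>" "A \<in> sets M" "A \<subseteq> B" "A \<subseteq> B'"
  shows "weight C B * P B A = weight C B' * P B' A"
proof -
  let ?D = "B \<union> B' \<union> C"
  have D: "?D \<in> dom \<nu>"
    using assms(1-3) by (intro dom_Un)
  have "weight C B * P B A = P ?D A / P ?D C"
    by (rule weight_mult_P[OF assms(1,3) D _ assms(4,5)]) blast
  moreover have "weight C B' * P B' A = P ?D A / P ?D C"
    by (rule weight_mult_P[OF assms(2,3) D _ assms(4,6)]) blast
  ultimately show ?thesis
    by simp
qed

lemma obtain_measure:
  obtains \<mu> where "\<mu> \<in> sigma_finite_measures_on M" "\<nu> \<subseteq>\<^sub>m conditionals \<mu>"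
proof -
  obtain B :: "nat \<Rightarrow> 'a set" where B: "\<And>i. B i \<in> dom \<nu>" "(\<Union>i. B i) = space M"
    using bunch unfolding bunch_def by metis
  \<comment> \<open>Any member of the bunch could be the reference set; the cover provides
    one.\<close>
  define C where "C = B 0"
  have C: "C \<in> dom \<nu>"
    using B by (simp add: C_def)
  have ran: "range B \<subseteq> sets M"
    using B sets_if_dom by blast
  have disj: "disjointed B n \<in> sets M" for n
    using sets.range_disjointed_sets[OF ran] by blast
  \<comment> \<open>Cutting the weighted conditional measure down to the n-th disjoint piece
    prevents overlaps of the cover from being counted twice in the sum.\<close>
  define N where
    "N n = density (the (\<nu> (B n))) (\<lambda>x. ennreal (weight C (B n)) * indicator (disjointed B n) x)" for n
  have sets_N: "sets (N n) = sets M" for n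
    using sets_cond B by (simp add: N_def)
  have N: "emeasure (N n) A = ennreal (weight C (B n) * P (B n) (A \<inter> disjointed B n))"
    if "A \<in> sets M" for n A
  proof -
    interpret prob_space "the (\<nu> (B n))"
      using prob_space_cond B by blast
    have [measurable]: "A \<in> sets (the (\<nu> (B n)))" "disjointed B n \<in> sets (the (\<nu> (B n)))"
      using that disj sets_cond[OF B(1)] by simp_all
    have "emeasure (N n) A = (\<integral>\<^sup>+x. ennreal (weight C (B n)) * indicator (A \<inter> disjointed B n) x \<partial>the (\<nu> (B n)))"
      unfolding N_def
      by (subst emeasure_density) (auto simp: ac_simps intro!: nn_integral_cong split: split_indicator)
    also have "\<dots> = ennreal (weight C (B n)) * emeasure (the (\<nu> (B n))) (A \<inter> disjointed B n)"
      by (intro nn_integral_cmult_indicator) measurable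
    finally show ?thesis
      using weight_pos[OF B(1)[of n] C] by (simp add: emeasure_eq_measure ennreal_mult)
  qed
  define \<mu> where "\<mu> = measure_of (space M) (sets M) (\<lambda>A. \<Sum>n. emeasure (N n) A)"
  have sets_\<mu>: "sets \<mu> = sets M" and space_\<mu>: "space \<mu> = space M"
    by (simp_all add: \<mu>_def)
  \<comment> \<open>On subsets of a member \<open>D\<close> of the bunch the glued measure no longer
    depends on the chosen cover.\<close>
  have \<mu>: "emeasure \<mu> A = ennreal (weight C D * P D A)"
    if A: "A \<in> sets M" "A \<subseteq> D" and D: "D \<in> dom \<nu>" for A D
  proof -
    interpret prob_space "the (\<nu> D)"
      using prob_space_cond D by blast
    have "emeasure \<mu> A = (\<Sum>n. emeasure (N n) A)"
      unfolding \<mu>_def by (rule emeasure_measure_of_suminf[OF sets_N A(1)])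
    also have "\<dots> = (\<Sum>n. ennreal (weight C D) * emeasure (the (\<nu> D)) (A \<inter> disjointed B n))"
    proof (rule suminf_cong)
      fix n
      \<comment> \<open>The n-th piece of \<open>A\<close> lies in both \<open>B n\<close> and
        \<open>D\<close>, so \<open>B n\<close> may be traded for \<open>D\<close>. Then one measure
        is summed over a partition of \<open>A\<close>.\<close>
      have "weight C (B n) * P (B n) (A \<inter> disjointed B n) = weight C D * P D (A \<inter> disjointed B n)"
        using A D B C disj disjointed_subset[of B n] by (intro weight_mult_P_eq) auto
      then show "emeasure (N n) A = ennreal (weight C D) * emeasure (the (\<nu> D)) (A \<inter> disjointed B n)"
        using A weight_pos[OF D C] by (simp add: N emeasure_eq_measure ennreal_mult)
    qed
    also have "\<dots> = ennreal (weight C D) * (\<Sum>n. emeasure (the (\<nu> D)) (A \<inter> disjointed B n))"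
      by (rule ennreal_suminf_cmult)
    also have "(\<Sum>n. emeasure (the (\<nu> D)) (A \<inter> disjointed B n)) = emeasure (the (\<nu> D)) A"
      using ran B A sets_cond[OF D] space_cond[OF D]
      by (intro emeasure_eq_suminf_disjointed[symmetric]) auto
    finally show ?thesis
      using weight_pos[OF D C] by (simp add: emeasure_eq_measure ennreal_mult)
  qed
  \<comment> \<open>By \<open>P_self\<close>, the measure of \<open>D\<close> is its weight, which
    is positive and finite.\<close>
  have adm: "admissible \<mu> D" if "D \<in> dom \<nu>" for D
    using \<mu>[of D D] that weight_pos[OF that C] P_self[OF that] sets_if_dom[OF that] sets_\<mu>
    by (simp add: admissible_def)
  have "\<mu> \<in> sigma_finite_measures_on M"
    using sets_\<mu> space_\<mu> adm B unfolding sigma_finite_measures_on_def by blast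
  moreover have "\<nu> D = conditionals \<mu> D" if D: "D \<in> dom \<nu>" for D
  proof -
    interpret prob_space "the (\<nu> D)"
      using prob_space_cond D by blast
    have "the (\<nu> D) = uniform_measure \<mu> D"
    proof (rule measure_eqI)
      fix A assume "A \<in> sets (the (\<nu> D))"
      then have A: "A \<in> sets M"
        using sets_cond[OF D] by simp
      have "emeasure (uniform_measure \<mu> D) A = emeasure \<mu> (D \<inter> A) / emeasure \<mu> D"
        using A D sets_if_dom sets_\<mu> by (intro emeasure_uniform_measure) auto
      also have "\<dots> = ennreal (weight C D * P D (D \<inter> A)) / ennreal (weight C D * P D D)"
        using A D sets_if_dom[OF D] \<mu>[of "D \<inter> A" D] \<mu>[of D D] by simp
      \<comment> \<open>The weight cancels, and concentration on \<open>D\<close> removes the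
        intersection.\<close>
      also have "\<dots> = ennreal (P D A)"
        using A P_restrict[OF D A] P_self[OF D] weight_pos[OF D C]
        by (simp add: divide_ennreal Int_commute)
      finally show "emeasure (the (\<nu> D)) A = emeasure (uniform_measure \<mu> D) A"
        by (simp add: emeasure_eq_measure)
    qed (simp add: sets_cond[OF D] sets_\<mu>)
    with D adm[OF D] show ?thesis
      by (auto simp: conditionals_def)
  qed
  then have "\<nu> \<subseteq>\<^sub>m conditionals \<mu>"
    by (simp add: map_le_def)
  ultimately show ?thesis
    by (rule that)
qed

end

subsection \<open>Maximal Renyi spaces\<close>

text \<open>As inclusion of partial maps, extension inherits transitivity and antisymmetry.\<close>

lemma renyi_extends_iff:
  "renyi_extends M \<nu>2 \<nu>1 \<longleftrightarrow> renyi_space M \<nu>2 \<and> renyi_space M \<nu>1 \<and> \<nu>1 \<subseteq>\<^sub>m \<nu>2"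
  unfolding renyi_extends_def using map_le_implies_dom_le[of \<nu>1 \<nu>2] by (auto simp: map_le_def)

lemma map_le_dom_eq: "f \<subseteq>\<^sub>m g \<Longrightarrow> dom f = dom g \<Longrightarrow> f = g"
  by (rule map_le_antisym) (simp_all add: map_le_def)

text \<open>An extension \<nu>' of these conditionals has a measure \<mu>' behind it. The
  conditionals of \<mu>' then contain those of \<mu>, so the two measures are proportional and
  \<nu>' is squeezed between equal maps.\<close>

lemma maximal_renyi_space_conditionals:
  assumes "\<mu> \<in> sigma_finite_measures_on M"
  shows "maximal_renyi_space M (conditionals \<mu>)"
  unfolding maximal_renyi_space_def
proof (intro conjI notI)
  show R: "renyi_space M (conditionals \<mu>)"
    by (rule renyi_space_conditionals) (rule assms)
  assume "\<exists>\<nu>'. renyi_extends M \<nu>' (conditionals \<mu>) \<and> dom (conditionals \<mu>) \<noteq> dom \<nu>'"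
  then obtain \<nu>' where \<nu>': "renyi_space M \<nu>'" "conditionals \<mu> \<subseteq>\<^sub>m \<nu>'" "dom (conditionals \<mu>) \<noteq> dom \<nu>'"
    unfolding renyi_extends_iff by blast
  interpret renyi M \<nu>'
    by standard (rule \<nu>'(1))
  obtain \<mu>' where \<mu>': "\<mu>' \<in> sigma_finite_measures_on M" "\<nu>' \<subseteq>\<^sub>m conditionals \<mu>'"
    by (rule obtain_measure)
  have "(\<mu>', \<mu>) \<in> c_equiv M"
    using assms map_le_refl \<mu>'(1) map_le_trans[OF \<nu>'(2) \<mu>'(2)]
  proof (rule c_equiv_if_map_le_conditionals)
    show "bunch M (dom (conditionals \<mu>))"
      using R by (simp add: renyi_space_def)
  qed
  then have "\<nu>' \<subseteq>\<^sub>m conditionals \<mu>"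
    using \<mu>'(2) conditionals_eq_if_c_equiv by metis
  with \<nu>' show False
    using map_le_implies_dom_le by blast
qed

text \<open>The conditionals of the measure behind \<nu> extend \<nu>, and maximality rules out that
  this extension is strict.\<close>

lemma maximal_renyi_space_obtain:
  assumes "maximal_renyi_space M \<nu>"
  obtains \<mu> where "\<mu> \<in> sigma_finite_measures_on M" "\<nu> = conditionals \<mu>"
proof -
  interpret renyi M \<nu>
    using assms by unfold_locales (simp add: maximal_renyi_space_def)
  obtain \<mu> where \<mu>: "\<mu> \<in> sigma_finite_measures_on M" "\<nu> \<subseteq>\<^sub>m conditionals \<mu>"
    by (rule obtain_measure)
  then have "renyi_extends M (conditionals \<mu>) \<nu>"
    using renyi renyi_space_conditionals by (auto simp: renyi_extends_iff)
  then have "dom \<nu> = dom (conditionals \<mu>)"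
    using assms by (auto simp: maximal_renyi_space_def)
  with \<mu> show ?thesis
    by (intro that[of \<mu>] map_le_dom_eq)
qed

text \<open>Any maximal extension consists of the conditionals of some measure. Two such measures
  agree with \<nu> on its bunch, hence are proportional and have the same conditionals.\<close>

lemma ex1_maximal_renyi_extension:
  assumes "renyi_space M \<nu>"
  shows "\<exists>!\<nu>'. maximal_renyi_space M \<nu>' \<and> renyi_extends M \<nu>' \<nu>"
proof -
  interpret renyi M \<nu>
    by standard (rule assms)
  obtain \<mu> where \<mu>: "\<mu> \<in> sigma_finite_measures_on M" "\<nu> \<subseteq>\<^sub>m conditionals \<mu>"
    by (rule obtain_measure)
  show ?thesis
  proof (rule ex1I[of _ "conditionals \<mu>"])
    show "maximal_renyi_space M (conditionals \<mu>) \<and> renyi_extends M (conditionals \<mu>) \<nu>"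
      using \<mu> assms maximal_renyi_space_conditionals renyi_space_conditionals
      by (auto simp: renyi_extends_iff)
  next
    fix \<nu>' assume \<nu>': "maximal_renyi_space M \<nu>' \<and> renyi_extends M \<nu>' \<nu>"
    then obtain \<mu>' where \<mu>': "\<mu>' \<in> sigma_finite_measures_on M" "\<nu>' = conditionals \<mu>'"
      using maximal_renyi_space_obtain by blast
    have "(\<mu>', \<mu>) \<in> c_equiv M"
      using \<mu> \<mu>' \<nu>' assms
      by (intro c_equiv_if_map_le_conditionals[of _ _ \<nu>]) (auto simp: renyi_extends_iff renyi_space_def)
    then show "\<nu>' = conditionals \<mu>"
      using \<mu>'(2) conditionals_eq_if_c_equiv by metis
  qed
qed

lemma bij_betw_generated_renyi:
  "bij_betw generated_renyi (c_measures M) {\<nu>. maximal_renyi_space M \<nu>}"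
proof (rule bij_betw_imageI)
  show "inj_on generated_renyi (c_measures M)"
  proof (rule inj_onI)
    fix \<gamma> \<gamma>' assume \<gamma>: "\<gamma> \<in> c_measures M" "\<gamma>' \<in> c_measures M" "generated_renyi \<gamma> = generated_renyi \<gamma>'"
    obtain \<mu> \<mu>' where \<mu>: "\<mu> \<in> sigma_finite_measures_on M" "\<gamma> = c_equiv M `` {\<mu>}"
      and \<mu>': "\<mu>' \<in> sigma_finite_measures_on M" "\<gamma>' = c_equiv M `` {\<mu>'}"
      using \<gamma> by (auto simp: c_measures_def elim!: quotientE)
    have "conditionals \<mu> = conditionals \<mu>'"
      using \<gamma>(3) \<mu> \<mu>' by (simp add: generated_renyi_class)
    moreover have "bunch M (dom (conditionals \<mu>))"
      using renyi_space_conditionals[OF \<mu>(1)] by (simp add: renyi_space_def)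
    \<comment> \<open>Here the common family of all conditionals plays the part of the Renyi space
      that determines the measure up to a factor.\<close>
    ultimately have "(\<mu>, \<mu>') \<in> c_equiv M"
      using \<mu>(1) \<mu>'(1)
      by (intro c_equiv_if_map_le_conditionals[of _ _ "conditionals \<mu>"]) auto
    then show "\<gamma> = \<gamma>'"
      using \<mu> \<mu>' equiv_class_eq[OF equiv_c_equiv] by metis
  qed
  show "generated_renyi ` c_measures M = {\<nu>. maximal_renyi_space M \<nu>}"
  proof (intro equalityI subsetI)
    fix \<nu> assume "\<nu> \<in> generated_renyi ` c_measures M"
    then show "\<nu> \<in> {\<nu>. maximal_renyi_space M \<nu>}"
      by (auto simp: c_measures_def generated_renyi_class maximal_renyi_space_conditionals
          elim!: quotientE)
  next
    fix \<nu> assume "\<nu> \<in> {\<nu>. maximal_renyi_space M \<nu>}"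
    then obtain \<mu> where "\<mu> \<in> sigma_finite_measures_on M" "\<nu> = conditionals \<mu>"
      using maximal_renyi_space_obtain by blast
    then show "\<nu> \<in> generated_renyi ` c_measures M"
      unfolding c_measures_def by (metis generated_renyi_class imageI quotientI)
  qed
qed

theorem corollary1:
  fixes M :: "'a measure"
  assumes "space M \<noteq> {}"
  shows "(\<forall>\<nu>. renyi_space M \<nu> \<longrightarrow>
            (\<exists>!\<nu>'. maximal_renyi_space M \<nu>' \<and> renyi_extends M \<nu>' \<nu>)) \<and>
         bij_betw generated_renyi (c_measures M) {\<nu>. maximal_renyi_space M \<nu>}"
  using ex1_maximal_renyi_extension bij_betw_generated_renyi by blast

end
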